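(* Let $\mathbf{L}$ be either $\mathbf{P}[\bot]$ or $\mathbf{P}[\bot_w]$, and let $I=\langle\mathcal A,v\rangle$ be a plain interpretation of $\mathbf{L}$. For every set $\Gamma$ of infons there exists an $\mathbf{L}$-closed set $M$ with $v(\Gamma)\subseteq M$ such that for every infon $\varphi$, if $\Gamma\not\vdash\varphi$ in $\mathbf{L}$ then $v(\varphi)\notin M$.
   Context: Infons: fix a set $At$ of atomic infons; infons are generated by $\varphi ::= \top\mid\bot \mid At \mid (\varphi\wedge\varphi)\mid(\varphi\to\varphi)$. Basic rules: from $\varphi_1,\varphi_2$ infer $\varphi_1\wedge\varphi_2$; from $\varphi_1\wedge\varphi_2$ infer $\varphi_i$ ($i=1,2$); from $\varphi_2$ infer $\varphi_1\to\varphi_2$; from $\varphi_1$ and $\varphi_1\to\varphi_2$ infer $\varphi_2$. $\mathbf{P}[\bot]$ adds: from $\bot$ infer any $\varphi$. $\mathbf{P}[\bot_w]$ instead adds: from $\bot$ and $\varphi\to\psi$ infer $\psi$. In $\mathbf{L}$, $\Gamma\vdash\varphi$ iff there is a finite sequence ending in $\varphi$ whose members are in $\Gamma\cup\{\top\}$ or follow from earlier members by the rules of $\mathbf{L}$; $T$ is deductively closed in $\mathbf{L}$ if $T\vdash\psi$ implies $\psi\in T$. Infon algebras: $\Sigma=\{0,1\}$, $\mathsf f\notin\Sigma$, $\Sigma_\bot=\Sigma\cup\{\mathsf f\}$. $\mathcal A=\langle\Sigma_\bot^*,\pi,l,r,\mathrm{enc},\mathrm{dec},E\rangle$ with $\pi,\mathrm{enc}:(\Sigma_\bot^*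 )^2\to\Sigma_\bot^*$ total, $l,r,\mathrm{dec}$ partial, $l(\pi(x,y))=x$, $r(\pi(x,y))=y$, $\mathrm{dec}(x,\mathrm{enc}(x,y))=y$ defined and valid for all $x,y$, all functions mapping arguments in $\Sigma^*$ to values in $\Sigma^*$, and $\emptyset\ne E\subseteq\Sigma^*$; for $\mathbf{P}[\bot_w]$ additionally a partial operation $\mathrm{crack}$ with $\mathrm{crack}(\mathsf f,\mathrm{enc}(a,b))=b$. An interpretation is $I=\langle\mathcal A,v\rangle$ with $v:At\cup\{\top,\bot\}\to\Sigma_\bot^*$, $v(\bot)=\mathsf f$, $v(\top)\in E$, $v(p)\in\Sigma^*$ for $p\in At$, extended by $v(\varphi_1\wedge\varphi_2)=\pi(v(\varphi_1),v(\varphi_2))$, $v(\varphi_1\to\varphi_2)=\mathrm{enc}(v(\varphi_1),v(\varphi_2))$, $v(\Gamma)=\{v(\psi):\psi\in\Gamma\}$. $M\subseteq\Sigma_\bot^*$ is $\mathbf{L}$-closed if $E\subseteq M$ and for all $a,b\in\Sigma_\bot^*$: (1) $a,b\in M\iff\pi(a,b)\in M$; (2) $a,\mathrm{enc}(a,b)\in M\Rightarrow b\in M$; (3) $b\in M\Rightarrow\mathrm{enc}(a,b)\in M$; for $\mathbf{P}[\bot]$: (4) $\mathsf f\in M$ implies $M=\Sigma_\bot^*$; for $\mathbf{P}[\bot_w]$: (4') $\mathsf f\in M$ and $\mathrm{enc}(a,b)\in M$ imply $b\in M$. The interpretation is plain for $\mathbf{L}$ if it is injective ($v(\varphi_1)=v(\varphi_2)$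 implies $\varphi_1=\varphi_2$) and conservative (for every set $T$ deductively closed in $\mathbf{L}$, the least $\mathbf{L}$-closed set containing $v(T)$ contains no string $v(\psi)$ with $\psi\notin T$). *)

theory Defs
  imports Main "HOL.Hull"
begin

datatype 'a basic = Top | Bot | Atom 'a

datatype 'a infon =
    Basic "'a basic"
  | Conj "'a infon" "'a infon"
  | Impl "'a infon" "'a infon"

text \<open>\<open>P_bot\<close> has the full rule for falsum, \<open>P_bot_weak\<close> the weak one.\<close>

datatype logic = P_bot | P_bot_weak

text \<open>\<open>infer L ps \<phi>\<close>: \<open>\<phi>\<close> follows from the list of premises \<open>ps\<close> by a single rule of \<open>L\<close>.\<close>

inductive infer :: "logic \<Rightarrow> 'a infon list \<Rightarrow> 'a infon \<Rightarrow> bool" for L :: logic where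
  conj_intro: "infer L [\<phi>\<^sub>1, \<phi>\<^sub>2] (Conj \<phi>\<^sub>1 \<phi>\<^sub>2)"
| conj_elim1: "infer L [Conj \<phi>\<^sub>1 \<phi>\<^sub>2] \<phi>\<^sub>1"
| conj_elim2: "infer L [Conj \<phi>\<^sub>1 \<phi>\<^sub>2] \<phi>\<^sub>2"
| impl_intro: "infer L [\<phi>\<^sub>2] (Impl \<phi>\<^sub>1 \<phi>\<^sub>2)"
| impl_elim: "infer L [\<phi>\<^sub>1, Impl \<phi>\<^sub>1 \<phi>\<^sub>2] \<phi>\<^sub>2"
| bot: "L = P_bot \<Longrightarrow> infer L [Basic Bot] \<phi>"
| bot_weak: "L = P_bot_weak \<Longrightarrow> infer L [Basic Bot, Impl \<phi> \<psi>] \<psi>"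

definition derivation :: "logic \<Rightarrow> 'a infon set \<Rightarrow> 'a infon list \<Rightarrow> bool" where
  "derivation L \<Gamma> ds \<longleftrightarrow>
     (\<forall>i < length ds. ds ! i \<in> \<Gamma> \<union> {Basic Top} \<or>
        (\<exists>ps. set ps \<subseteq> set (take i ds) \<and> infer L ps (ds ! i)))"

definition derives :: "logic \<Rightarrow> 'a infon set \<Rightarrow> 'a infon \<Rightarrow> bool" where
  "derives L \<Gamma> \<phi> \<longleftrightarrow> (\<exists>ds. ds \<noteq> [] \<and> last ds = \<phi> \<and> derivation L \<Gamma> ds)"

definition deductively_closed :: "logic \<Rightarrow> 'a infon set \<Rightarrow> bool" where
  "deductively_closed L T \<longleftrightarrow> (\<forall>\<psi>. derives L T \<psi> \<longrightarrow> \<psi> \<in> T)"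

datatype symbol = Zero | One | Falsum

type_synonym word = "symbol list"

abbreviation binary_words :: "word set" where
  "binary_words \<equiv> lists {Zero, One}"

text \<open>
  Partial operations are \<open>option\<close>-valued. The component \<open>crack\<close> is constrained only for
  \<open>P_bot_weak\<close>; algebras for \<open>P_bot\<close> do not have it, and it plays no role there.
\<close>

record infon_alg =
  pr :: "word \<Rightarrow> word \<Rightarrow> word"
  lproj :: "word \<Rightarrow> word option"
  rproj :: "word \<Rightarrow> word option"
  enc :: "word \<Rightarrow> word \<Rightarrow> word"
  dec :: "word \<Rightarrow> word \<Rightarrow> word option"
  crack :: "word \<Rightarrow> word \<Rightarrow> word option"
  E :: "word set"

definition infon_algebra :: "logic \<Rightarrow> infon_alg \<Rightarrow> bool" where
  "infon_algebra L A \<longleftrightarrow>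
     (\<forall>x y. lproj A (pr A x y) = Some x) \<and>
     (\<forall>x y. rproj A (pr A x y) = Some y) \<and>
     (\<forall>x y. dec A x (enc A x y) = Some y) \<and>
     (\<forall>x\<in>binary_words. \<forall>y\<in>binary_words. pr A x y \<in> binary_words) \<and>
     (\<forall>x\<in>binary_words. \<forall>y\<in>binary_words. enc A x y \<in> binary_words) \<and>
     (\<forall>x\<in>binary_words. \<forall>z. lproj A x = Some z \<longrightarrow> z \<in> binary_words) \<and>
     (\<forall>x\<in>binary_words. \<forall>z. rproj A x = Some z \<longrightarrow> z \<in> binary_words) \<and>
     (\<forall>x\<in>binary_words. \<forall>y\<in>binary_words. \<forall>z. dec A x y = Some z \<longrightarrow> z \<in> binary_words) \<and>
     E A \<noteq> {} \<and> E A \<subseteq> binary_words \<and>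
     (L = P_bot_weak \<longrightarrow> (\<forall>a b. crack A [Falsum] (enc A a b) = Some b))"

definition interpretation_of :: "logic \<Rightarrow> infon_alg \<Rightarrow> ('a basic \<Rightarrow> word) \<Rightarrow> bool" where
  "interpretation_of L A v \<longleftrightarrow>
     infon_algebra L A \<and>
     v Bot = [Falsum] \<and> v Top \<in> E A \<and> (\<forall>p. v (Atom p) \<in> binary_words)"

primrec ext :: "infon_alg \<Rightarrow> ('a basic \<Rightarrow> word) \<Rightarrow> 'a infon \<Rightarrow> word" where
  "ext A v (Basic b) = v b"
| "ext A v (Conj \<phi>\<^sub>1 \<phi>\<^sub>2) = pr A (ext A v \<phi>\<^sub>1) (ext A v \<phi>\<^sub>2)"
| "ext A v (Impl \<phi>\<^sub>1 \<phi>\<^sub>2) = enc A (ext A v \<phi>\<^sub>1) (ext A v \<phi>\<^sub>2)"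

definition L_closed :: "logic \<Rightarrow> infon_alg \<Rightarrow> word set \<Rightarrow> bool" where
  "L_closed L A M \<longleftrightarrow>
     E A \<subseteq> M \<and>
     (\<forall>a b. a \<in> M \<and> b \<in> M \<longleftrightarrow> pr A a b \<in> M) \<and>
     (\<forall>a b. a \<in> M \<and> enc A a b \<in> M \<longrightarrow> b \<in> M) \<and>
     (\<forall>a b. b \<in> M \<longrightarrow> enc A a b \<in> M) \<and>
     (L = P_bot \<longrightarrow> [Falsum] \<in> M \<longrightarrow> M = UNIV) \<and>
     (L = P_bot_weak \<longrightarrow> (\<forall>a b. [Falsum] \<in> M \<and> enc A a b \<in> M \<longrightarrow> b \<in> M))"

text \<open>
  \<open>L_closed L A hull X\<close> is the intersection of all \<open>L\<close>-closed sets containing \<open>X\<close>. The next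
  two lemmas show that it is itself \<open>L\<close>-closed, hence the least \<open>L\<close>-closed set containing \<open>X\<close>.
\<close>

lemma L_closed_Inter:
  assumes closed: "\<And>M. M \<in> \<M> \<Longrightarrow> L_closed L A M"
  shows "L_closed L A (\<Inter>\<M>)"
proof -
  have E: "E A \<subseteq> M"
    and pr: "a \<in> M \<and> b \<in> M \<longleftrightarrow> pr A a b \<in> M"
    and mp: "a \<in> M \<Longrightarrow> enc A a b \<in> M \<Longrightarrow> b \<in> M"
    and wk: "b \<in> M \<Longrightarrow> enc A a b \<in> M"
    and bot: "L = P_bot \<Longrightarrow> [Falsum] \<in> M \<Longrightarrow> M = UNIV"
    and bot_weak: "L = P_bot_weak \<Longrightarrow> [Falsum] \<in> M \<Longrightarrow> enc A a b \<in> M \<Longrightarrow> b \<in> M"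
    if "M \<in> \<M>" for M a b
    using closed[OF that, unfolded L_closed_def] by metis+
  show ?thesis
    unfolding L_closed_def
  proof (intro conjI allI impI)
    show "E A \<subseteq> \<Inter>\<M>"
      using E by (rule Inter_greatest)
  next
    fix a b
    have "a \<in> \<Inter>\<M> \<and> b \<in> \<Inter>\<M> \<longleftrightarrow> (\<forall>M\<in>\<M>. a \<in> M \<and> b \<in> M)"
      by auto
    also have "\<dots> \<longleftrightarrow> pr A a b \<in> \<Inter>\<M>"
      using pr by simp
    finally show "a \<in> \<Inter>\<M> \<and> b \<in> \<Inter>\<M> \<longleftrightarrow> pr A a b \<in> \<Inter>\<M>" .
  next
    fix a b assume "a \<in> \<Inter>\<M> \<and> enc A a b \<in> \<Inter>\<M>"
    then show "b \<in> \<Inter>\<M>"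
      by (intro InterI) (meson InterD mp)
  next
    fix a b assume "b \<in> \<Inter>\<M>"
    then show "enc A a b \<in> \<Inter>\<M>"
      by (intro InterI) (meson InterD wk)
  next
    assume "L = P_bot" "[Falsum] \<in> \<Inter>\<M>"
    then have "M = UNIV" if "M \<in> \<M>" for M
      using bot that InterD by metis
    then show "\<Inter>\<M> = UNIV"
      by simp
  next
    fix a b assume "L = P_bot_weak" "[Falsum] \<in> \<Inter>\<M> \<and> enc A a b \<in> \<Inter>\<M>"
    then show "b \<in> \<Inter>\<M>"
      by (intro InterI) (meson InterD bot_weak)
  qed
qed

lemma L_closed_hull_least:
  "L_closed L A (L_closed L A hull X)"
  "X \<subseteq> L_closed L A hull X"
  "L_closed L A M \<Longrightarrow> X \<subseteq> M \<Longrightarrow> L_closed L A hull X \<subseteq> M"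
proof -
  show "L_closed L A (L_closed L A hull X)"
    by (rule hull_in) (auto intro: L_closed_Inter)
  show "X \<subseteq> L_closed L A hull X"
    by (rule hull_subset)
  show "L_closed L A M \<Longrightarrow> X \<subseteq> M \<Longrightarrow> L_closed L A hull X \<subseteq> M"
    by (rule hull_minimal)
qed

definition conservative :: "logic \<Rightarrow> infon_alg \<Rightarrow> ('a basic \<Rightarrow> word) \<Rightarrow> bool" where
  "conservative L A v \<longleftrightarrow>
     (\<forall>T. deductively_closed L T \<longrightarrow>
        (\<forall>\<psi>. \<psi> \<notin> T \<longrightarrow> ext A v \<psi> \<notin> L_closed L A hull (ext A v ` T)))"

definition plain :: "logic \<Rightarrow> infon_alg \<Rightarrow> ('a basic \<Rightarrow> word) \<Rightarrow> bool" where
  "plain L A v \<longleftrightarrow> inj (ext A v) \<and> conservative L A v"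

end

theory Submission
  imports Defs
begin

text \<open>
  The consequences of \<open>\<Gamma>\<close> form a deductively closed set, so conservativity applies to it: the least
  closed set containing their values is the required \<open>M\<close>.
\<close>

text \<open>Each entry of \<open>es\<close> is justified by \<open>\<Gamma>\<close>, by truth or by
  entries before it in \<open>es\<close>; putting \<open>ds\<close> in front only enlarges the stock
  of earlier entries.\<close>

lemma derivation_append:
  assumes "derivation L \<Gamma> ds" "derivation L \<Gamma> es"
  shows "derivation L \<Gamma> (ds @ es)"
  unfolding derivation_def
proof (intro allI impI)
  fix i assume i: "i < length (ds @ es)"
  show "(ds @ es) ! i \<in> \<Gamma> \<union> {Basic Top} \<or>
    (\<exists>ps. set ps \<subseteq> set (take i (ds @ es)) \<and> infer L ps ((ds @ es) ! i))"
  proof (cases "i < length ds")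
    case True
    then show ?thesis
      using assms(1) by (simp add: derivation_def nth_append)
  next
    case False
    then have "i - length ds < length es" "(ds @ es) ! i = es ! (i - length ds)"
      using i by (auto simp: nth_append)
    \<comment> \<open>Position \<open>i\<close> of the joint list is position
      \<open>i - length ds\<close> of \<open>es\<close>, so the premises available there remain
      available.\<close>
    moreover have "set (take (i - length ds) es) \<subseteq> set (take i (ds @ es))"
      by simp
    ultimately show ?thesis
      using assms(2) unfolding derivation_def by (metis subset_trans)
  qed
qed

lemma derivation_snoc:
  assumes "derivation L \<Gamma> ds"
    and "\<phi> \<in> \<Gamma> \<union> {Basic Top} \<or> (\<exists>ps. set ps \<subseteq> set ds \<and> infer L ps \<phi>)"
  shows "derivation L \<Gamma> (ds @ [\<phi>])"
  using assms by (auto simp: derivation_def nth_append less_Suc_eq)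

lemma derives_axiom: "\<phi> \<in> \<Gamma> \<union> {Basic Top} \<Longrightarrow> derives L \<Gamma> \<phi>"
  unfolding derives_def derivation_def by (rule exI[of _ "[\<phi>]"]) simp

text \<open>A rule may have several premises, each with a derivation of its own. Concatenating these
  yields a single list in which all premises occur, to which the conclusion can then be
  appended.\<close>

lemma common_derivation:
  assumes "\<forall>\<psi>\<in>set ps. derives L \<Gamma> \<psi>"
  shows "\<exists>ds. derivation L \<Gamma> ds \<and> set ps \<subseteq> set ds"
  using assms
proof (induction ps)
  case Nil
  then show ?case
    by (auto simp: derivation_def intro: exI[of _ "[]"])
next
  case (Cons \<psi> ps)
  then obtain ds where ds: "derivation L \<Gamma> ds" "set ps \<subseteq> set ds"
    by auto
  \<comment> \<open>Being the last entry is weakened to membership, which survives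
    concatenation.\<close>
  from Cons.prems obtain es where es: "derivation L \<Gamma> es" "\<psi> \<in> set es"
    unfolding derives_def by (metis last_in_set list.set_intros(1))
  show ?case
    using ds es by (intro exI[of _ "ds @ es"]) (auto intro: derivation_append)
qed

lemma derives_infer:
  assumes "\<forall>\<psi>\<in>set ps. derives L \<Gamma> \<psi>" "infer L ps \<phi>"
  shows "derives L \<Gamma> \<phi>"
proof -
  obtain ds where "derivation L \<Gamma> ds" "set ps \<subseteq> set ds"
    using common_derivation[OF assms(1)] by blast
  then have "derivation L \<Gamma> (ds @ [\<phi>])"
    using assms(2) by (blast intro: derivation_snoc)
  then show ?thesis
    unfolding derives_def by (metis snoc_eq_iff_butlast)
qed

text \<open>A form of cut: along a derivation from the consequences of \<open>\<Gamma>\<close>,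
  every entry is itself a consequence of \<open>\<Gamma>\<close>, in particular the last
  one.\<close>

lemma deductively_closed_consequences: "deductively_closed L {\<phi>. derives L \<Gamma> \<phi>}"
  unfolding deductively_closed_def
proof (intro allI impI)
  fix \<psi> assume "derives L {\<phi>. derives L \<Gamma> \<phi>} \<psi>"
  then obtain ds where ds: "ds \<noteq> []" "last ds = \<psi>" "derivation L {\<phi>. derives L \<Gamma> \<phi>} ds"
    unfolding derives_def by blast
  have "derives L \<Gamma> (ds ! i)" if "i < length ds" for i
    using that
  \<comment> \<open>Strong induction is required because premises may stand at any earlier
    positions.\<close>
  proof (induction i rule: less_induct)
    case (less i)
    consider "ds ! i \<in> {\<phi>. derives L \<Gamma> \<phi>} \<union> {Basic Top}"
      | ps where "set ps \<subseteq> set (take i ds)" "infer L ps (ds ! i)"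
      using ds(3) less.prems unfolding derivation_def by blast
    then show ?case
    proof cases
      case 1
      then show ?thesis
        using derives_axiom by blast
    next
      case 2
      \<comment> \<open>A member of \<open>take i ds\<close> is \<open>ds ! j\<close> for some
        \<open>j < i\<close>, so the induction hypothesis covers it.\<close>
      have "\<forall>\<chi>\<in>set ps. derives L \<Gamma> \<chi>"
        using 2(1) less by (fastforce simp: in_set_conv_nth)
      then show ?thesis
        using 2(2) derives_infer by blast
    qed
  qed
  then show "\<psi> \<in> {\<phi>. derives L \<Gamma> \<phi>}"
    using ds(1,2) by (auto simp: last_conv_nth)
qed

theorem theorem4:
  fixes L :: logic and A :: infon_alg and v :: "'a basic \<Rightarrow> word" and \<Gamma> :: "'a infon set"
  assumes "interpretation_of L A v"
    and "plain L A v"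
  shows "\<exists>M. L_closed L A M \<and> ext A v ` \<Gamma> \<subseteq> M \<and>
           (\<forall>\<phi>. \<not> derives L \<Gamma> \<phi> \<longrightarrow> ext A v \<phi> \<notin> M)"
proof -
  define T where "T = {\<phi>. derives L \<Gamma> \<phi>}"
  define M where "M = L_closed L A hull (ext A v ` T)"
  have "L_closed L A M" "ext A v ` T \<subseteq> M"
    unfolding M_def by (rule L_closed_hull_least)+
  moreover have "\<Gamma> \<subseteq> T"
    unfolding T_def by (auto intro: derives_axiom)
  \<comment> \<open>Non-derivability from \<open>\<Gamma>\<close> is exactly
    \<open>\<phi> \<notin> T\<close>, the case that conservativity excludes from the hull.\<close>
  moreover have "ext A v \<phi> \<notin> M" if "\<not> derives L \<Gamma> \<phi>" for \<phi>
    using assms(2) that deductively_closed_consequences[of L \<Gamma>]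
    unfolding plain_def conservative_def M_def T_def by blast
  ultimately show ?thesis
    by blast
qed

end
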